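(* Consider the Stackelberg game with companies $\mathcal{K}$ as leaders and consumers $\mathcal{N}$ as followers described in the context, and assume that each consumer's budget $B_n$ satisfies $$B_n\ \ge\ \frac{E_n^{\min}+\zeta_n KT}{\sum_{k\in\mathcal{K}}\sum_{t\in\mathcal{T}}\frac{1}{KT\,p_k(t)}}-\zeta_n\sum_{k\in\mathcal{K}}\sum_{t\in\mathcal{T}}p_k(t)$$ for the announced prices $p_k(t)$. Then: (i) There exists a unique (open-loop) Nash equilibrium for the price-selection game among the companies, and it is given by $$p_k^*(t)=\frac{B}{G_k(t)+Z}\left(\frac{1}{KT-\sum_{j\in\mathcal{K}}\sum_{h\in\mathcal{T}}\frac{Z}{G_j(h)+Z}}\right),\qquad k\in\mathcal{K},\ t\in\mathcal{T},$$ where $B=\sum_{n\in\mathcal{N}}B_n$ and $Z=\sum_{n\in\mathcal{N}}\zeta_n$. (ii) There exists a unique (open-loop) Stackelberg equilibrium, and it is given by the prices $p_k^*(t)$ in (i) together with the demands $$d^*_{n,k}(t)=\frac{B_n+\sum_{j\in\mathcal{K}}\sum_{h\in\mathcal{T}}p^*_j(h)\zeta_n}{KT\,p^*_k(t)}-\zeta_n,\qquad n\in\mathcal{N},\ k\in\mathcal{K},\ t\in\mathcal{T}.$$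
   Context: $\mathcal{K}=\{1,\dots,K\}$ is the set of companies, $\mathcal{N}=\{1,\dots,N\}$ the set of consumers, $\mathcal{T}=\{1,\dots,T\}$ the set of time slots. Data: power availabilities $G_k(t)>0$; for each consumer $n$, a budget $B_n\ge 0$ (with $B=\sum_n B_n>0$), minimum energy need $E_n^{\min}\ge 0$, and parameters $\gamma_n>0$, $\zeta_n\ge 1$. Consumer problem (followers; no game among consumers). Given prices $p_k(t)>0$, consumer $n$ maximizes $u_n(\mathbf{d}_n)=\gamma_n\sum_{k\in\mathcal{K}}\sum_{t\in\mathcal{T}}\ln(\zeta_n+d_{n,k}(t))$ subject to $\sum_{k,t}p_k(t)d_{n,k}(t)\le B_n$, $\sum_{k,t}d_{n,k}(t)\ge E_n^{\min}$, and $d_{n,k}(t)\ge 0$ for all $k,t$. In the paper, the optimal response $\mathbf{d}^*_n(\mathbf{p})$ to a price profile $\mathbf{p}$ is the unique maximizer and is taken to be $$d^*_{n,k}(\mathbf{p},t)=\frac{B_n+\sum_{j\in\mathcal{K}}\sum_{h\in\mathcal{T}}p_j(h)\zeta_n}{KT\,p_k(t)}-\zeta_n .$$ Company problem (leaders; price-selection Nash game). Company $k$ chooses $\mathbf{p}_k=(p_k(t))_{t\in\mathcal{T}}$ in $\mathcal{L}_k=\prod_{t\in\mathcal{T}}[p_k^{\min}(t),p_k^{\max}(t)]$, $p_k(t)>0$. Given the other companies' prices $\mathbf{p}_{-k}$, it maximizes the revenue $$\pi_k(\mathbf{p}_k,\mathbf{p}_{-k})=\sum_{t\in\mathcal{T}}p_k(t)\sum_{n\in\mathcal{N}}d^*_{n,k}(\mathbf{p}_k,\mathbf{p}_{-k},t)$$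 subject to $\sum_{n\in\mathcal{N}}d^*_{n,k}(\mathbf{p}_k,\mathbf{p}_{-k},t)\le G_k(t)$ for all $t\in\mathcal{T}$. Convention: if the value $p_k^*(t)$ given by the formula falls below $p_k^{\min}(t)$ it is set to $p_k^{\min}(t)$, and if it exceeds $p_k^{\max}(t)$ it is set to $p_k^{\max}(t)$. A Nash equilibrium of the price-selection game is a feasible price profile at which no company can increase its revenue by a unilateral feasible change of its own prices. A Stackelberg equilibrium is a pair $(\mathbf{p}^*,\mathbf{d}^*(\mathbf{p}^* ))$ in which $\mathbf{p}^*$ is such that, for each $k$, $\pi_k(\mathbf{p}^*_k,\mathbf{p}^*_{-k})\ge\pi_k(\mathbf{p}_k,\mathbf{p}^*_{-k})$ for all admissible $\mathbf{p}_k$, revenues being evaluated at the consumers' optimal responses. "Open-loop" means that all prices for all periods are announced at the beginning, and consumers then respond (a one-shot game).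
   Formalization: Assumes at least two companies (for K=1 revenue is constantly B, so uniqueness fails) and, if clipping to the price bounds changes the formula, that the clipped prices meet all constraints (else they are no equilibrium); the budget bound is assumed for all admissible prices. *)

theory Defs
  imports Complex_Main "HOL-Library.Cardinality"
begin

text \<open>
  Companies, time slots and consumers are the elements of finite (hence nonempty) types
  \<open>'k\<close>, \<open>'t\<close>, \<open>'n\<close>, so that \<open>K = CARD('k)\<close>, \<open>T = CARD('t)\<close>, \<open>N = CARD('n)\<close>.
\<close>

type_synonym ('k, 't) profile = "'k \<Rightarrow> 't \<Rightarrow> real"

definition utility :: "real \<Rightarrow> real \<Rightarrow> ('k::finite, 't::finite) profile \<Rightarrow> real" where
  "utility \<gamma> \<zeta> d = \<gamma> * (\<Sum>k\<in>UNIV. \<Sum>t\<in>UNIV. ln (\<zeta> + d k t))"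

definition consumer_feasible ::
    "real \<Rightarrow> real \<Rightarrow> ('k::finite, 't::finite) profile \<Rightarrow> ('k, 't) profile set" where
  "consumer_feasible b e p =
     {d. (\<Sum>k\<in>UNIV. \<Sum>t\<in>UNIV. p k t * d k t) \<le> b \<and>
         (\<Sum>k\<in>UNIV. \<Sum>t\<in>UNIV. d k t) \<ge> e \<and>
         (\<forall>k t. d k t \<ge> 0)}"

text \<open>
  The consumers' response to the prices \<open>p\<close> is given in closed form. This is the stationary point
  of the utility on the budget hyperplane; it is the maximizer over \<^const>\<open>consumer_feasible\<close>
  only where it is nonnegative and the minimum energy need is met.
\<close>
definition demand ::
    "('n \<Rightarrow> real) \<Rightarrow> ('n \<Rightarrow> real) \<Rightarrow> ('k::finite, 't::finite) profile \<Rightarrow> 'n \<Rightarrow> ('k, 't) profile" where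
  "demand B \<zeta> p n k t =
     (B n + (\<Sum>j\<in>UNIV. \<Sum>h\<in>UNIV. p j h * \<zeta> n)) / (real CARD('k) * real CARD('t) * p k t) - \<zeta> n"

definition revenue ::
    "('n::finite \<Rightarrow> real) \<Rightarrow> ('n \<Rightarrow> real) \<Rightarrow> ('k::finite, 't::finite) profile \<Rightarrow> 'k \<Rightarrow> real" where
  "revenue B \<zeta> p k = (\<Sum>t\<in>UNIV. p k t * (\<Sum>n\<in>UNIV. demand B \<zeta> p n k t))"

definition price_box :: "('k, 't) profile \<Rightarrow> ('k, 't) profile \<Rightarrow> ('k, 't) profile set" where
  "price_box pmin pmax = {p. \<forall>k t. p k t \<in> {pmin k t..pmax k t} \<and> 0 < p k t}"

text \<open>
  Feasibility of company \<open>k\<close>'s own prices \<open>p k\<close>, given the prices of the others; the capacity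
  constraints of the other companies are not imposed on \<open>k\<close>.
\<close>
definition company_feasible ::
    "('n::finite \<Rightarrow> real) \<Rightarrow> ('n \<Rightarrow> real) \<Rightarrow> ('k, 't) profile \<Rightarrow> ('k, 't) profile \<Rightarrow> ('k, 't) profile
      \<Rightarrow> ('k::finite, 't::finite) profile \<Rightarrow> 'k \<Rightarrow> bool" where
  "company_feasible B \<zeta> G pmin pmax p k \<longleftrightarrow>
     (\<forall>t. p k t \<in> {pmin k t..pmax k t} \<and> 0 < p k t \<and>
          (\<Sum>n\<in>UNIV. demand B \<zeta> p n k t) \<le> G k t)"

definition nash_equilibrium ::
    "('n::finite \<Rightarrow> real) \<Rightarrow> ('n \<Rightarrow> real) \<Rightarrow> ('k, 't) profile \<Rightarrow> ('k, 't) profile \<Rightarrow> ('k, 't) profile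
      \<Rightarrow> ('k::finite, 't::finite) profile \<Rightarrow> bool" where
  "nash_equilibrium B \<zeta> G pmin pmax p \<longleftrightarrow>
     (\<forall>k. company_feasible B \<zeta> G pmin pmax p k) \<and>
     (\<forall>k q. company_feasible B \<zeta> G pmin pmax (p(k := q)) k \<longrightarrow>
        revenue B \<zeta> (p(k := q)) k \<le> revenue B \<zeta> p k)"

text \<open>
  Revenues in \<^const>\<open>nash_equilibrium\<close> are already evaluated at the consumers' responses, so the
  leaders' part of a Stackelberg equilibrium is the Nash condition on prices.
\<close>
definition stackelberg_equilibrium ::
    "('n::finite \<Rightarrow> real) \<Rightarrow> ('n \<Rightarrow> real) \<Rightarrow> ('k, 't) profile \<Rightarrow> ('k, 't) profile \<Rightarrow> ('k, 't) profile
      \<Rightarrow> ('k::finite, 't::finite) profile \<times> ('n \<Rightarrow> ('k, 't) profile) \<Rightarrow> bool" where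
  "stackelberg_equilibrium B \<zeta> G pmin pmax = (\<lambda>(p, d).
     nash_equilibrium B \<zeta> G pmin pmax p \<and> d = demand B \<zeta> p)"

definition price_formula ::
    "('n::finite \<Rightarrow> real) \<Rightarrow> ('n \<Rightarrow> real) \<Rightarrow> ('k::finite, 't::finite) profile \<Rightarrow> ('k, 't) profile" where
  "price_formula B \<zeta> G k t =
     (let Z = \<Sum>n\<in>UNIV. \<zeta> n in
       (\<Sum>n\<in>UNIV. B n) / (G k t + Z) *
       (1 / (real CARD('k) * real CARD('t) - (\<Sum>j\<in>UNIV. \<Sum>h\<in>UNIV. Z / (G j h + Z)))))"

text \<open>
  All capacity constraints bind at \<^const>\<open>price_formula\<close> and are coupled through the sum of all
  prices, so the profile obtained by clipping to the box need not satisfy them any more.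
\<close>
definition equilibrium_prices ::
    "('n::finite \<Rightarrow> real) \<Rightarrow> ('n \<Rightarrow> real) \<Rightarrow> ('k::finite, 't::finite) profile
      \<Rightarrow> ('k, 't) profile \<Rightarrow> ('k, 't) profile \<Rightarrow> ('k, 't) profile" where
  "equilibrium_prices B \<zeta> G pmin pmax k t =
     (let x = price_formula B \<zeta> G k t in
       if x < pmin k t then pmin k t else if pmax k t < x then pmax k t else x)"

end

theory Submission
  imports Defs
begin

text \<open>
  Write \<open>\<beta>\<close> and \<open>Z\<close> for the sums of the budgets and of the parameters \<open>\<zeta>\<close>, \<open>M = K T\<close>, and \<open>S\<close>
  for the sum of all prices. Summing the consumers' demands shows that the demand for \<open>(k, t)\<close> is
  \<open>(\<beta> + Z S) / (M p\<^sub>k(t)) - Z\<close>. Two things follow. The capacity constraint is the lower bound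
  \<open>p\<^sub>k(t) \<ge> (\<beta> + Z S) / (M (G\<^sub>k(t) + Z))\<close> (\<open>capacity_iff\<close>), and the revenue of a company depends
  on its own prices only through their sum, with slope \<open>Z / K - Z < 0\<close> when there are at least two
  companies (\<open>revenue_deviation_le_iff\<close>). So every company wants its prices as low as possible.

  The lower bounds increase with \<open>S\<close>, so a company can always lower its prices to the current
  bounds without leaving its feasible set. Hence the Nash equilibria are exactly the feasible
  fixed points of the map taking \<open>p\<close> to the larger of \<open>p\<^sup>m\<^sup>i\<^sup>n\<close> and the lower bounds
  at \<open>p\<close> (\<open>nash_equilibrium_iff\<close>). The bounds grow with \<open>S\<close> at a total rate
  \<open>\<Sum> Z / (M (G\<^sub>k(t) + Z)) < 1\<close>, which makes this map a contraction in \<open>S\<close> and its fixed point unique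
  (\<open>fixed_point_unique\<close>).

  It remains to see that the clipped price formula is a fixed point. The formula solves the
  equations in which all capacity bounds are tight. If no clipping occurs, it is thus a fixed point.
  If clipping occurs and the clipped profile is still feasible, the contraction argument shows that
  it lies above the formula; its sum is then larger, so all its bounds are strictly above the
  formula, and every price must have been clipped to \<open>p\<^sup>m\<^sup>i\<^sup>n\<close>
  (\<open>clipped_formula_fixed_point\<close>).

  The followers' part is a tangent line argument: \<open>ln x \<le> x - 1\<close>, with equality only at \<open>1\<close>, bounds
  the utility of any affordable bundle by that of the demand (\<open>demand_is_unique_maximizer\<close>).
\<close>

section \<open>Self-bounding sums\<close>

text \<open>
  Summing the hypothesis gives \<open>D \<le> W D\<close> for \<open>D = \<Sum> x - \<Sum> y\<close> and \<open>W = \<Sum> w < 1\<close>, so \<open>D\<close> is not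
  positive. The hypothesis may use \<open>D > 0\<close>, as in a proof by contradiction. This is the
  contraction property from which optimality and uniqueness are derived.
\<close>
lemma sum_le_of_self_bounded_differences:
  fixes x y w :: "'a \<Rightarrow> real"
  assumes w: "sum w A < 1"
    and le: "\<And>i. i \<in> A \<Longrightarrow> sum y A < sum x A \<Longrightarrow> x i - y i \<le> w i * (sum x A - sum y A)"
  shows "sum x A \<le> sum y A"
proof (rule ccontr)
  assume "\<not> sum x A \<le> sum y A"
  then have less: "sum y A < sum x A" by simp
  have "sum x A - sum y A = (\<Sum>i\<in>A. x i - y i)"
    by (simp add: sum_subtractf)
  also have "\<dots> \<le> (\<Sum>i\<in>A. w i * (sum x A - sum y A))"
    using le less by (intro sum_mono) auto
  also have "\<dots> = sum w A * (sum x A - sum y A)"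
    by (simp add: sum_distrib_right)
  also have "\<dots> < 1 * (sum x A - sum y A)"
    using w less by (intro mult_strict_right_mono) auto
  finally show False by simp
qed

definition total_price :: "('k::finite, 't::finite) profile \<Rightarrow> real" where
  "total_price p = (\<Sum>k\<in>UNIV. \<Sum>t\<in>UNIV. p k t)"

lemma total_price_eq_sum_pairs: "total_price p = (\<Sum>i\<in>UNIV. p (fst i) (snd i))"
  by (simp add: total_price_def sum.cartesian_product case_prod_beta flip: UNIV_Times_UNIV)

lemma total_price_mono: "(\<And>k t. p k t \<le> q k t) \<Longrightarrow> total_price p \<le> total_price q"
  by (auto simp: total_price_def intro!: sum_mono)

lemma total_price_fun_upd:
  "total_price (p(k := q)) = total_price p - sum (p k) UNIV + sum q UNIV"
proof -
  have "total_price r = sum (r k) UNIV + (\<Sum>j\<in>UNIV - {k}. sum (r j) UNIV)" for r :: "('a, 'b) profile"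
    unfolding total_price_def by (rule sum.remove) auto
  from this[of p] this[of "p(k := q)"] show ?thesis by simp
qed

section \<open>The price-selection game\<close>

text \<open>
  The number \<open>M\<close> of company-slot pairs is a parameter because its value depends only on the types
  \<open>'k\<close> and \<open>'t\<close>, which a constant of type \<^typ>\<open>real\<close> does not determine.
\<close>
locale price_game =
  fixes B \<zeta> :: "'n::finite \<Rightarrow> real"
    and G pmin pmax :: "('k::finite, 't::finite) profile"
    and M :: real
  assumes M_eq: "M = real CARD('k) * real CARD('t)"
    and two_companies: "CARD('k) \<ge> 2"
    and G_pos: "\<And>k t. G k t > 0"
    and B_pos: "(\<Sum>n\<in>UNIV. B n) > 0"
    and zeta_pos: "\<And>n. \<zeta> n > 0"
begin

abbreviation Btot :: real where "Btot \<equiv> \<Sum>n\<in>UNIV. B n"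
abbreviation Z :: real where "Z \<equiv> \<Sum>n\<in>UNIV. \<zeta> n"

text \<open>The price of \<open>(k, t)\<close> at which its capacity is exactly used up when all prices sum to \<open>s\<close>.\<close>
definition clearing_price :: "real \<Rightarrow> ('k, 't) profile" where
  "clearing_price s k t = (Btot + Z * s) / (M * (G k t + Z))"

text \<open>The rate at which the clearing price grows with the sum of all prices.\<close>
definition slope :: "('k, 't) profile" where
  "slope k t = Z / (M * (G k t + Z))"

definition fixed_point :: "('k, 't) profile \<Rightarrow> bool" where
  "fixed_point p \<longleftrightarrow> (\<forall>k t. p k t = max (pmin k t) (clearing_price (total_price p) k t))"

abbreviation feasible :: "('k, 't) profile \<Rightarrow> 'k \<Rightarrow> bool" where
  "feasible \<equiv> company_feasible B \<zeta> G pmin pmax"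

abbreviation formula :: "('k, 't) profile" where
  "formula \<equiv> price_formula B \<zeta> G"

lemma M_pos [simp]: "M > 0"
  by (simp add: M_eq)

lemma M_nonzero [simp]: "M \<noteq> 0"
  using M_pos by linarith

lemma Z_pos: "Z > 0"
  using zeta_pos by (intro sum_pos) auto

lemma GZ_pos: "G k t + Z > 0"
  using G_pos[of k t] Z_pos by linarith

lemma slope_pos: "slope k t > 0"
  using Z_pos GZ_pos by (simp add: slope_def)

lemma slope_less: "slope k t < 1 / M"
proof -
  have "Z / (G k t + Z) < 1"
    using G_pos[of k t] GZ_pos[of k t] by simp
  then have "Z / (G k t + Z) / M < 1 / M"
    using M_pos by (intro divide_strict_right_mono)
  then show ?thesis by (simp add: slope_def mult.commute)
qed

lemma total_slope_less_1: "total_price slope < 1"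
proof -
  have "total_price slope < (\<Sum>k\<in>(UNIV::'k set). \<Sum>t\<in>(UNIV::'t set). 1 / M)"
    unfolding total_price_def using slope_less by (intro sum_strict_mono) auto
  also have "\<dots> = 1" by (simp add: M_eq)
  finally show ?thesis .
qed

lemma company_slope_less_1: "sum (slope k) UNIV < 1"
proof -
  have "sum (slope k) UNIV \<le> total_price slope"
    unfolding total_price_def using slope_pos
    by (intro member_le_sum) (auto intro!: sum_nonneg slope_pos[THEN less_imp_le])
  then show ?thesis using total_slope_less_1 by simp
qed

lemma clearing_price_diff:
  "clearing_price s k t - clearing_price s' k t = slope k t * (s - s')"
  by (simp add: clearing_price_def slope_def diff_divide_distrib[symmetric] algebra_simps)

lemma clearing_price_mono: "s \<le> s' \<Longrightarrow> clearing_price s k t \<le> clearing_price s' k t"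
  using clearing_price_diff[of s' k t s] slope_pos[of k t]
  by (smt (verit) mult_nonneg_nonneg)

lemma clearing_price_strict_mono: "s < s' \<Longrightarrow> clearing_price s k t < clearing_price s' k t"
  using clearing_price_diff[of s' k t s] slope_pos[of k t]
  by (smt (verit) mult_pos_pos)

lemma clearing_price_pos: "s \<ge> 0 \<Longrightarrow> clearing_price s k t > 0"
  using B_pos Z_pos unfolding clearing_price_def
  by (intro divide_pos_pos add_pos_nonneg mult_pos_pos mult_nonneg_nonneg M_pos GZ_pos) auto

section \<open>Aggregate demand, capacity and revenue\<close>

lemma aggregate_demand:
  fixes p :: "('k, 't) profile"
  shows "(\<Sum>n\<in>UNIV. demand B \<zeta> p n k t) = (Btot + Z * total_price p) / (M * p k t) - Z"
proof -
  have "demand B \<zeta> p n k t = (B n + \<zeta> n * total_price p) / (M * p k t) - \<zeta> n" for n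
    by (simp add: demand_def M_eq total_price_def sum_distrib_left mult.commute)
  then show ?thesis
    by (simp add: sum_subtractf sum.distrib flip: sum_divide_distrib sum_distrib_right)
qed

lemma capacity_iff:
  fixes p :: "('k, 't) profile"
  assumes "p k t > 0"
  shows "(\<Sum>n\<in>UNIV. demand B \<zeta> p n k t) \<le> G k t \<longleftrightarrow> clearing_price (total_price p) k t \<le> p k t"
proof -
  have "(\<Sum>n\<in>UNIV. demand B \<zeta> p n k t) \<le> G k t
      \<longleftrightarrow> (Btot + Z * total_price p) / (M * p k t) \<le> G k t + Z"
    unfolding aggregate_demand by linarith
  also have "\<dots> \<longleftrightarrow> Btot + Z * total_price p \<le> (G k t + Z) * (M * p k t)"
    using assms M_pos by (intro pos_divide_le_eq mult_pos_pos)
  also have "(G k t + Z) * (M * p k t) = p k t * (M * (G k t + Z))"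
    by simp
  also have "Btot + Z * total_price p \<le> p k t * (M * (G k t + Z))
      \<longleftrightarrow> clearing_price (total_price p) k t \<le> p k t"
    unfolding clearing_price_def using GZ_pos[of k t] M_pos
    by (intro pos_divide_le_eq[symmetric] mult_pos_pos)
  finally show ?thesis .
qed

lemma feasible_iff:
  "feasible p k \<longleftrightarrow>
    (\<forall>t. pmin k t \<le> p k t \<and> p k t \<le> pmax k t \<and> 0 < p k t
      \<and> clearing_price (total_price p) k t \<le> p k t)"
  unfolding company_feasible_def using capacity_iff by auto

text \<open>Each slot earns the same amount \<open>(\<beta> + Z S) / M\<close>, less \<open>Z\<close> times its price.\<close>
lemma revenue_eq:
  fixes p :: "('k, 't) profile"
  assumes "\<And>t. p k t > 0"
  shows "revenue B \<zeta> p k = (Btot + Z * total_price p) / real CARD('k) - Z * sum (p k) UNIV"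
proof -
  have "p k t * (\<Sum>n\<in>UNIV. demand B \<zeta> p n k t) = (Btot + Z * total_price p) / M - Z * p k t" for t
    using assms[of t] unfolding aggregate_demand by (simp add: field_simps)
  then show ?thesis
    by (simp add: revenue_def M_eq sum_subtractf flip: sum_distrib_left)
qed

text \<open>
  A company that raises its price sum by \<open>x\<close> gains \<open>Z x / K\<close> from the consumers' adjusted
  responses but loses \<open>Z x\<close> directly; with \<open>K \<ge> 2\<close> the loss prevails.
\<close>
lemma revenue_deviation_le_iff:
  fixes p :: "('k, 't) profile"
  assumes "\<And>t. p k t > 0" and "\<And>t. q t > 0"
  shows "revenue B \<zeta> (p(k := q)) k \<le> revenue B \<zeta> p k \<longleftrightarrow> sum (p k) UNIV \<le> sum q UNIV"
proof -
  let ?K = "real CARD('k)" and ?x = "sum q UNIV - sum (p k) UNIV"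
  have pos: "Z * (1 - 1 / ?K) > 0"
    using two_companies Z_pos by (intro mult_pos_pos) auto
  have "revenue B \<zeta> p k - revenue B \<zeta> (p(k := q)) k = Z * (1 - 1 / ?K) * ?x"
    using revenue_eq[of p k] revenue_eq[of "p(k := q)" k] assms
    by (simp add: total_price_fun_upd field_simps)
  then have "revenue B \<zeta> (p(k := q)) k \<le> revenue B \<zeta> p k \<longleftrightarrow> 0 \<le> Z * (1 - 1 / ?K) * ?x"
    by linarith
  also have "\<dots> \<longleftrightarrow> 0 \<le> ?x"
    using mult_le_cancel_left_pos[OF pos, of 0 ?x] by (simp only: mult_zero_right)
  finally show ?thesis by simp
qed

section \<open>Nash equilibria as fixed points\<close>

text \<open>
  At a fixed point a company cannot lower its price sum: doing so moves its bounds down by less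
  than the reduction, since its slopes sum to less than \<open>1\<close>.
\<close>
lemma fixed_point_minimizes_own_sum:
  assumes fp: "fixed_point p" and q: "feasible (p(k := q)) k"
  shows "sum (p k) UNIV \<le> sum q UNIV"
proof (rule sum_le_of_self_bounded_differences[OF company_slope_less_1[of k]])
  fix t assume less: "sum q UNIV < sum (p k) UNIV"
  let ?s = "total_price p" and ?s' = "total_price (p(k := q))"
  have s: "?s - ?s' = sum (p k) UNIV - sum q UNIV"
    by (simp add: total_price_fun_upd)
  have q_ge: "pmin k t \<le> q t" "clearing_price ?s' k t \<le> q t"
    using q by (auto simp: feasible_iff)
  have "slope k t * (sum (p k) UNIV - sum q UNIV) \<ge> 0"
    using slope_pos[of k t] less by simp
  moreover have "clearing_price ?s k t - q t \<le> slope k t * (sum (p k) UNIV - sum q UNIV)"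
    using clearing_price_diff[of ?s k t ?s'] s q_ge(2) by simp
  moreover have "p k t = max (pmin k t) (clearing_price ?s k t)"
    using fp by (simp add: fixed_point_def)
  ultimately show "p k t - q t \<le> slope k t * (sum (p k) UNIV - sum q UNIV)"
    using q_ge(1) by linarith
qed

text \<open>
  For the direction from left to right, let a company lower all its prices to
  the bounds computed at the current profile. This decreases the sum of all prices and with it the
  bounds, so the new prices are feasible; optimality then forces them to be the old ones.
\<close>
lemma nash_equilibrium_iff:
  "nash_equilibrium B \<zeta> G pmin pmax p \<longleftrightarrow> (\<forall>k. feasible p k) \<and> fixed_point p"
proof (intro iffI conjI; (elim conjE)?)
  assume nash: "nash_equilibrium B \<zeta> G pmin pmax p"
  then show feas: "\<forall>k. feasible p k"
    by (simp add: nash_equilibrium_def)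
  have p_pos: "p k t > 0" for k t
    using feas by (simp add: feasible_iff)
  have S_nonneg: "total_price p \<ge> 0"
    unfolding total_price_def using p_pos by (intro sum_nonneg) (simp add: less_imp_le)
  show "fixed_point p"
    unfolding fixed_point_def
  proof (intro allI)
    fix k t
    define q where "q = (\<lambda>t. max (pmin k t) (clearing_price (total_price p) k t))"
    have q_le: "q t \<le> p k t" for t
      using feas by (simp add: q_def feasible_iff)
    have q_pos: "q t > 0" for t
      using clearing_price_pos[OF S_nonneg, of k t] by (simp add: q_def)
    have "total_price (p(k := q)) \<le> total_price p"
      using q_le by (intro total_price_mono) simp
    then have "clearing_price (total_price (p(k := q))) k t \<le> q t" for t
      using clearing_price_mono[of "total_price (p(k := q))" "total_price p" k t]
      by (simp add: q_def)
    moreover have "pmin k t \<le> q t" "q t \<le> pmax k t" for t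
      using q_le[of t] feas by (auto simp: feasible_iff q_def intro: order_trans)
    ultimately have "feasible (p(k := q)) k"
      using q_pos by (simp add: feasible_iff)
    then have "revenue B \<zeta> (p(k := q)) k \<le> revenue B \<zeta> p k"
      using nash by (simp add: nash_equilibrium_def)
    then have "sum (p k) UNIV \<le> sum q UNIV"
      using revenue_deviation_le_iff[of p k q] p_pos q_pos by simp
    then have "sum q UNIV = sum (p k) UNIV"
      using q_le by (intro antisym sum_mono[of UNIV q]) auto
    then have "q t = p k t"
      using q_le by (rule sum_mono_inv[where I = UNIV]) auto
    then show "p k t = max (pmin k t) (clearing_price (total_price p) k t)"
      by (simp add: q_def)
  qed
next
  assume feas: "\<forall>k. feasible p k" and fp: "fixed_point p"
  have "revenue B \<zeta> (p(k := q)) k \<le> revenue B \<zeta> p k" if q: "feasible (p(k := q)) k" for k q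
  proof -
    have "q t > 0" for t
      using q by (simp add: feasible_iff)
    moreover have "p k t > 0" for t
      using feas by (simp add: feasible_iff)
    ultimately show ?thesis
      using fixed_point_minimizes_own_sum[OF fp q] revenue_deviation_le_iff[of p k q] by simp
  qed
  with feas show "nash_equilibrium B \<zeta> G pmin pmax p"
    by (simp add: nash_equilibrium_def)
qed

lemma fixed_point_total_le:
  assumes "fixed_point p" and "fixed_point q"
  shows "total_price p \<le> total_price q"
  unfolding total_price_eq_sum_pairs
proof (rule sum_le_of_self_bounded_differences)
  show "(\<Sum>i\<in>UNIV. slope (fst i) (snd i)) < 1"
    using total_slope_less_1 by (simp add: total_price_eq_sum_pairs)
next
  fix i :: "'k \<times> 't"
  assume "(\<Sum>i\<in>UNIV. q (fst i) (snd i)) < (\<Sum>i\<in>UNIV. p (fst i) (snd i))"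
  then have "total_price q < total_price p"
    by (simp add: total_price_eq_sum_pairs)
  moreover obtain k t where i: "i = (k, t)"
    by (cases i)
  ultimately have "slope k t * (total_price p - total_price q) \<ge> 0"
    using slope_pos[of k t] by simp
  moreover have "p k t = max (pmin k t) (clearing_price (total_price p) k t)"
    "q k t = max (pmin k t) (clearing_price (total_price q) k t)"
    using assms by (auto simp: fixed_point_def)
  ultimately have "p k t - q k t \<le> slope k t * (total_price p - total_price q)"
    using clearing_price_diff[of "total_price p" k t "total_price q"] by linarith
  then show "p (fst i) (snd i) - q (fst i) (snd i) \<le> slope (fst i) (snd i) *
      ((\<Sum>i\<in>UNIV. p (fst i) (snd i)) - (\<Sum>i\<in>UNIV. q (fst i) (snd i)))"
    by (simp add: i total_price_eq_sum_pairs)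
qed

lemma fixed_point_unique:
  assumes "fixed_point p" and "fixed_point q"
  shows "p = q"
proof -
  have "total_price p = total_price q"
    using assms by (intro antisym fixed_point_total_le)
  with assms show ?thesis
    by (intro ext) (simp add: fixed_point_def)
qed

section \<open>The price formula\<close>

lemma sum_ratio_eq: "(\<Sum>j\<in>UNIV. \<Sum>h\<in>UNIV. Z / (G j h + Z)) = M * total_price slope"
proof -
  have "Z / (G j h + Z) = M * slope j h" for j h
    unfolding slope_def times_divide_eq_right
    by (rule mult_divide_mult_cancel_left[OF M_nonzero, symmetric])
  then show ?thesis
    by (simp only: total_price_def sum_distrib_left)
qed

text \<open>
  Inserting \<open>p = clearing_price S\<close> into the definition of \<open>S\<close> gives a linear equation for \<open>S\<close>; its
  solution is \<open>\<beta> C / (1 - Z C)\<close> with \<open>C = \<Sum> 1 / (M (G\<^sub>k(t) + Z))\<close>, and \<open>Z C\<close> is the total slope.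
\<close>
lemma formula_eq_clearing_price: "formula k t = clearing_price (total_price formula) k t"
proof -
  let ?\<sigma> = "total_price slope"
  define c where "c = Btot / (1 - ?\<sigma>)"
  have \<sigma>: "1 - ?\<sigma> > 0"
    using total_slope_less_1 by simp
  have "M - (\<Sum>j\<in>UNIV. \<Sum>h\<in>UNIV. Z / (G j h + Z)) = M * (1 - ?\<sigma>)"
    unfolding sum_ratio_eq by (simp only: right_diff_distrib mult_1_right)
  then have formula: "formula j h = c / (M * (G j h + Z))" for j h
    by (simp add: price_formula_def Let_def c_def mult.commute flip: M_eq)
  have "Z * formula j h = c * slope j h" for j h
    by (simp add: formula slope_def)
  then have "Z * total_price formula = c * ?\<sigma>"
    by (simp add: total_price_def sum_distrib_left)
  moreover have "Btot = c * (1 - ?\<sigma>)"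
    using \<sigma> by (simp add: c_def)
  ultimately have "Btot + Z * total_price formula = c"
    by (simp add: algebra_simps)
  then show ?thesis
    by (simp add: formula clearing_price_def)
qed

lemma formula_pos: "formula k t > 0"
proof -
  have "M * total_price slope < M * 1"
    using total_slope_less_1 M_pos by (intro mult_strict_left_mono)
  then have "M - (\<Sum>j\<in>UNIV. \<Sum>h\<in>UNIV. Z / (G j h + Z)) > 0"
    unfolding sum_ratio_eq by linarith
  then show ?thesis
    using B_pos GZ_pos[of k t] by (simp add: price_formula_def Let_def flip: M_eq)
qed

lemma formula_total_le_feasible_total:
  assumes "\<And>k. feasible p k"
  shows "total_price formula \<le> total_price p"
  unfolding total_price_eq_sum_pairs
proof (rule sum_le_of_self_bounded_differences)
  show "(\<Sum>i\<in>UNIV. slope (fst i) (snd i)) < 1"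
    using total_slope_less_1 by (simp add: total_price_eq_sum_pairs)
next
  fix i :: "'k \<times> 't"
  obtain k t where i: "i = (k, t)"
    by (cases i)
  have "clearing_price (total_price p) k t \<le> p k t"
    using assms by (simp add: feasible_iff)
  then have "formula k t - p k t \<le> slope k t * (total_price formula - total_price p)"
    using clearing_price_diff[of "total_price formula" k t "total_price p"]
      formula_eq_clearing_price[of k t] by linarith
  then show "formula (fst i) (snd i) - p (fst i) (snd i) \<le> slope (fst i) (snd i) *
      ((\<Sum>i\<in>UNIV. formula (fst i) (snd i)) - (\<Sum>i\<in>UNIV. p (fst i) (snd i)))"
    by (simp add: i total_price_eq_sum_pairs)
qed

text \<open>
  The comparison of the sums passes to each price because the bounds increase with the sum. Thus
  the formula is below every profile that respects all capacities.
\<close>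
lemma formula_le_feasible:
  assumes "\<And>k. feasible p k"
  shows "formula k t \<le> p k t"
proof -
  have "formula k t \<le> clearing_price (total_price p) k t"
    using formula_total_le_feasible_total[OF assms]
    by (subst formula_eq_clearing_price) (rule clearing_price_mono)
  also have "\<dots> \<le> p k t"
    using assms by (simp add: feasible_iff)
  finally show ?thesis .
qed

abbreviation clipped :: "('k, 't) profile" where
  "clipped \<equiv> equilibrium_prices B \<zeta> G pmin pmax"

lemma unclipped_feasible:
  assumes "clipped = formula"
  shows "feasible clipped k"
proof -
  have "clipped k t = formula k t" for t
    using assms by simp
  then have "pmin k t \<le> formula k t \<and> formula k t \<le> pmax k t" for t
    by (smt (verit) equilibrium_prices_def)
  then show ?thesis
    using formula_pos formula_eq_clearing_price by (auto simp: assms feasible_iff)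
qed

text \<open>
  Feasibility is an all-or-nothing condition on clipping: raising a single price above the formula
  raises every bound above it, so a profile that clipping has changed can be feasible
  only if it is \<open>pmin\<close> throughout.
\<close>
lemma clipped_formula_fixed_point:
  assumes feas: "\<And>k. feasible clipped k"
  shows "fixed_point clipped"
proof (cases "clipped = formula")
  case True
  then show ?thesis
    using feas formula_eq_clearing_price
    by (auto simp: fixed_point_def feasible_iff max_def intro: antisym)
next
  case False
  let ?s = "total_price clipped"
  have le: "formula k t \<le> clipped k t" for k t
    using formula_le_feasible[OF feas] .
  have "total_price formula \<noteq> ?s"
  proof
    assume "total_price formula = ?s"
    then have sum_eq: "(\<Sum>i\<in>UNIV. formula (fst i) (snd i)) = (\<Sum>i\<in>UNIV. clipped (fst i) (snd i))"
      by (simp add: total_price_eq_sum_pairs)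
    have "formula k t = clipped k t" for k t
      using sum_mono_inv[OF sum_eq, of "(k, t)"] le by simp
    then show False
      using False by (metis ext)
  qed
  then have "total_price formula < ?s"
    using total_price_mono[of formula clipped, OF le] by simp
  then have "formula k t < clearing_price ?s k t" for k t
    by (subst formula_eq_clearing_price) (rule clearing_price_strict_mono)
  moreover have clearing_le: "clearing_price ?s k t \<le> clipped k t" for k t
    using feas by (simp add: feasible_iff)
  ultimately have less: "formula k t < clipped k t" for k t
    by (rule less_le_trans)
  have "clipped k t = pmin k t" for k t
    using less[of k t] by (auto simp: equilibrium_prices_def Let_def split: if_splits)
  then show ?thesis
    using clearing_le by (simp add: fixed_point_def)
qed

lemma clipped_formula_unique_nash:
  assumes "clipped \<noteq> formula \<Longrightarrow> \<forall>k. feasible clipped k"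
  shows "nash_equilibrium B \<zeta> G pmin pmax p \<longleftrightarrow> p = clipped"
proof -
  have feas: "feasible clipped k" for k
    using assms unclipped_feasible by (cases "clipped = formula") auto
  then show ?thesis
    using clipped_formula_fixed_point[OF feas] fixed_point_unique nash_equilibrium_iff by blast
qed

end

section \<open>The consumers' optimal response\<close>

text \<open>
  The demands of a consumer sum to \<open>(B n + \<zeta> n * S) * H - M * \<zeta> n\<close>, where \<open>H\<close> is the sum of the
  \<open>1 / (M * p k t)\<close>. The bound on the budget says that this is at least \<open>e\<close>, solved for \<open>B n\<close>.
\<close>
lemma demand_feasible:
  fixes p :: "('k::finite, 't::finite) profile"
  assumes p_pos: "\<And>k t. p k t > 0"
    and budget: "B n \<ge> (e + \<zeta> n * real CARD('k) * real CARD('t))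
              / (\<Sum>k\<in>UNIV. \<Sum>t\<in>UNIV. 1 / (real CARD('k) * real CARD('t) * p k t))
            - \<zeta> n * (\<Sum>k\<in>UNIV. \<Sum>t\<in>UNIV. p k t)"
    and nonneg: "\<And>k t. demand B \<zeta> p n k t \<ge> 0"
  shows "demand B \<zeta> p n \<in> consumer_feasible (B n) e p"
    and "(\<Sum>k\<in>UNIV. \<Sum>t\<in>UNIV. p k t * demand B \<zeta> p n k t) = B n"
proof -
  define M where "M = real CARD('k) * real CARD('t)"
  define S where "S = (\<Sum>k\<in>UNIV. \<Sum>t\<in>UNIV. p k t)"
  define H where "H = (\<Sum>k\<in>UNIV. \<Sum>t\<in>UNIV. 1 / (M * p k t))"
  have M: "M > 0"
    by (simp add: M_def)
  have d: "demand B \<zeta> p n k t = (B n + \<zeta> n * S) * (1 / (M * p k t)) - \<zeta> n" for k t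
    by (simp add: demand_def M_def S_def sum_distrib_left mult.commute)
  have H: "H > 0"
    unfolding H_def using M p_pos by (intro sum_pos) auto
  have "p k t * demand B \<zeta> p n k t = (B n + \<zeta> n * S) / M - \<zeta> n * p k t" for k t
    using p_pos[of k t] M by (simp add: d field_simps)
  then have "(\<Sum>k\<in>UNIV. \<Sum>t\<in>UNIV. p k t * demand B \<zeta> p n k t) =
      M * ((B n + \<zeta> n * S) / M) - \<zeta> n * S"
    by (simp add: sum_subtractf S_def M_def flip: sum_distrib_left)
  then show tight: "(\<Sum>k\<in>UNIV. \<Sum>t\<in>UNIV. p k t * demand B \<zeta> p n k t) = B n"
    using M by simp
  have total: "(\<Sum>k\<in>UNIV. \<Sum>t\<in>UNIV. demand B \<zeta> p n k t) = (B n + \<zeta> n * S) * H - M * \<zeta> n"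
    by (simp add: d sum_subtractf H_def M_def sum_distrib_left)
  have "(e + \<zeta> n * M) / H \<le> B n + \<zeta> n * S"
    using budget by (simp add: M_def S_def H_def mult.assoc)
  then have "e + \<zeta> n * M \<le> (B n + \<zeta> n * S) * H"
    using H by (simp add: pos_divide_le_eq)
  with total have "(\<Sum>k\<in>UNIV. \<Sum>t\<in>UNIV. demand B \<zeta> p n k t) \<ge> e"
    by (simp add: mult.commute)
  with tight nonneg show "demand B \<zeta> p n \<in> consumer_feasible (B n) e p"
    by (simp add: consumer_feasible_def)
qed

text \<open>
  At the demand all marginal utilities per unit of money are equal, up to the factor \<open>\<gamma>\<close>
  to \<open>M / W\<close> with \<open>W = B n + \<zeta> n * S\<close>. Bounding the logarithms by their tangents there, the
  utility gained, again up to \<open>\<gamma>\<close>, is at most \<open>M / W\<close> times the extra money spent, which is not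
  positive. Tangents touch only at one point, so a bundle of the same utility must be the demand.
\<close>
lemma feasible_utility_ge_demand_imp_eq:
  fixes p :: "('k::finite, 't::finite) profile"
  assumes p_pos: "\<And>k t. p k t > 0" and b: "B n \<ge> 0" and zeta: "\<zeta> n > 0" and gamma: "\<gamma> > 0"
    and tight: "(\<Sum>k\<in>UNIV. \<Sum>t\<in>UNIV. p k t * demand B \<zeta> p n k t) = B n"
    and d: "d \<in> consumer_feasible (B n) e p"
    and ge: "utility \<gamma> (\<zeta> n) d \<ge> utility \<gamma> (\<zeta> n) (demand B \<zeta> p n)"
  shows "d = demand B \<zeta> p n"
proof -
  define M where "M = real CARD('k) * real CARD('t)"
  define S where "S = (\<Sum>k\<in>UNIV. \<Sum>t\<in>UNIV. p k t)"
  define W where "W = B n + \<zeta> n * S"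
  let ?D = "demand B \<zeta> p n"
  have M: "M > 0"
    by (simp add: M_def)
  have "S > 0"
    unfolding S_def using p_pos by (intro sum_pos) auto
  then have W: "W > 0"
    using b zeta by (simp add: W_def add_nonneg_pos)
  have D: "\<zeta> n + ?D k t = W / (M * p k t)" for k t
    by (simp add: demand_def M_def S_def W_def sum_distrib_left mult.commute)
  define r where "r = (\<lambda>k t. (\<zeta> n + d k t) / (\<zeta> n + ?D k t))"
  have D_pos: "\<zeta> n + ?D k t > 0" for k t
    using W M p_pos[of k t] by (simp add: D)
  have d_pos: "\<zeta> n + d k t > 0" for k t
    using d zeta by (simp add: consumer_feasible_def add_pos_nonneg)
  have r_pos: "r k t > 0" for k t
    using D_pos d_pos by (simp add: r_def)
  have ln_r: "ln (\<zeta> n + d k t) - ln (\<zeta> n + ?D k t) = ln (r k t)" for k t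
    using D_pos[of k t] d_pos[of k t] by (simp add: r_def ln_div)
  have r_minus_1: "r k t - 1 = M / W * (p k t * d k t - p k t * ?D k t)" for k t
  proof -
    have "r k t - 1 = (d k t - ?D k t) / (\<zeta> n + ?D k t)"
      using D_pos[of k t] by (simp add: r_def field_simps)
    also have "\<dots> = M / W * (p k t * d k t - p k t * ?D k t)"
      unfolding D using W M p_pos[of k t] by (simp add: field_simps)
    finally show ?thesis .
  qed
  define g where "g = (\<lambda>i. r (fst i) (snd i) - 1 - ln (r (fst i) (snd i)))"
  have g_nonneg: "g i \<ge> 0" for i
    using ln_le_minus_one[OF r_pos] by (simp add: g_def)
  have "(\<Sum>k\<in>UNIV. \<Sum>t\<in>UNIV. ln (r k t)) \<ge> 0"
    using ge gamma unfolding ln_r[symmetric] by (simp add: utility_def sum_subtractf)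
  moreover have "(\<Sum>k\<in>UNIV. \<Sum>t\<in>UNIV. r k t - 1) \<le> 0"
  proof -
    have "(\<Sum>k\<in>UNIV. \<Sum>t\<in>UNIV. r k t - 1) =
        M / W * ((\<Sum>k\<in>UNIV. \<Sum>t\<in>UNIV. p k t * d k t) - B n)"
      unfolding r_minus_1 tight[symmetric]
      by (simp only: sum_subtractf flip: sum_distrib_left)
    also have "\<dots> \<le> 0"
      using d M W by (intro mult_nonneg_nonpos) (auto simp: consumer_feasible_def)
    finally show ?thesis .
  qed
  moreover have "(\<Sum>i\<in>UNIV. g i) =
      (\<Sum>k\<in>UNIV. \<Sum>t\<in>UNIV. r k t - 1) - (\<Sum>k\<in>UNIV. \<Sum>t\<in>UNIV. ln (r k t))"
    by (simp add: g_def sum_subtractf sum.cartesian_product case_prod_beta flip: UNIV_Times_UNIV)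
  ultimately have "(\<Sum>i\<in>UNIV. g i) = 0"
    using sum_nonneg[of UNIV g] g_nonneg by force
  then have g_zero: "g i = 0" for i
    using g_nonneg by (cases i) (simp add: sum_nonneg_eq_0_iff)
  have "d k t = ?D k t" for k t
  proof -
    have "ln (r k t) = r k t - 1"
      using g_zero[of "(k, t)"] by (simp add: g_def)
    then have "r k t = 1"
      by (rule ln_eq_minus_one[OF r_pos])
    then show ?thesis
      using D_pos[of k t] by (simp add: r_def)
  qed
  then show ?thesis
    by (intro ext)
qed

lemma demand_is_unique_maximizer:
  fixes p :: "('k::finite, 't::finite) profile"
  assumes p_pos: "\<And>k t. p k t > 0" and b: "B n \<ge> 0" and zeta: "\<zeta> n > 0" and gamma: "\<gamma> > 0"
    and budget: "B n \<ge> (e + \<zeta> n * real CARD('k) * real CARD('t))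
              / (\<Sum>k\<in>UNIV. \<Sum>t\<in>UNIV. 1 / (real CARD('k) * real CARD('t) * p k t))
            - \<zeta> n * (\<Sum>k\<in>UNIV. \<Sum>t\<in>UNIV. p k t)"
    and nonneg: "\<And>k t. demand B \<zeta> p n k t \<ge> 0"
  shows "is_arg_max (utility \<gamma> (\<zeta> n)) (\<lambda>d. d \<in> consumer_feasible (B n) e p) d
    \<longleftrightarrow> d = demand B \<zeta> p n"
proof -
  note feas = demand_feasible[OF p_pos budget nonneg]
  note eq = feasible_utility_ge_demand_imp_eq[OF p_pos b zeta gamma feas(2)]
  show ?thesis
  proof
    assume "is_arg_max (utility \<gamma> (\<zeta> n)) (\<lambda>d. d \<in> consumer_feasible (B n) e p) d"
    then show "d = demand B \<zeta> p n"
      using feas(1) by (intro eq) (auto simp: is_arg_max_def not_less)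
  next
    assume "d = demand B \<zeta> p n"
    then show "is_arg_max (utility \<gamma> (\<zeta> n)) (\<lambda>d. d \<in> consumer_feasible (B n) e p) d"
      using feas(1) eq unfolding is_arg_max_def by (metis less_imp_le less_irrefl)
  qed
qed

section \<open>Existence and uniqueness of the equilibria\<close>

theorem theorem2:
  fixes B E \<gamma> \<zeta> :: "'n::finite \<Rightarrow> real"
    and G pmin pmax :: "('k::finite, 't::finite) profile"
  assumes "CARD('k) \<ge> 2"
    and "\<And>k t. G k t > 0"
    and "\<And>n. B n \<ge> 0" and "(\<Sum>n\<in>UNIV. B n) > 0"
    and "\<And>n. E n \<ge> 0" and "\<And>n. \<gamma> n > 0" and "\<And>n. \<zeta> n \<ge> 1"
    and budget: "\<And>p n. p \<in> price_box pmin pmax \<Longrightarrow>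
      B n \<ge> (E n + \<zeta> n * real CARD('k) * real CARD('t))
              / (\<Sum>k\<in>UNIV. \<Sum>t\<in>UNIV. 1 / (real CARD('k) * real CARD('t) * p k t))
            - \<zeta> n * (\<Sum>k\<in>UNIV. \<Sum>t\<in>UNIV. p k t)"
    and clipping: "equilibrium_prices B \<zeta> G pmin pmax \<noteq> price_formula B \<zeta> G \<Longrightarrow>
      \<forall>k. company_feasible B \<zeta> G pmin pmax (equilibrium_prices B \<zeta> G pmin pmax) k"
  shows "((\<exists>!p. nash_equilibrium B \<zeta> G pmin pmax p) \<and>
          nash_equilibrium B \<zeta> G pmin pmax (equilibrium_prices B \<zeta> G pmin pmax)) \<and>
         ((\<exists>!pd. stackelberg_equilibrium B \<zeta> G pmin pmax pd) \<and>
          stackelberg_equilibrium B \<zeta> G pmin pmax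
            (equilibrium_prices B \<zeta> G pmin pmax,
             demand B \<zeta> (equilibrium_prices B \<zeta> G pmin pmax))) \<and>
         (\<forall>p\<in>price_box pmin pmax. \<forall>n. (\<forall>k t. demand B \<zeta> p n k t \<ge> 0) \<longrightarrow>
            (\<forall>d. is_arg_max (utility (\<gamma> n) (\<zeta> n)) (\<lambda>d. d \<in> consumer_feasible (B n) (E n) p) d
               \<longleftrightarrow> d = demand B \<zeta> p n))"
proof -
  have zeta_pos: "\<zeta> n > 0" for n
    using \<open>\<And>n. \<zeta> n \<ge> 1\<close>[of n] by linarith
  interpret price_game B \<zeta> G pmin pmax "real CARD('k) * real CARD('t)"
    using assms(1,2,4) zeta_pos by unfold_locales simp_all
  have nash: "nash_equilibrium B \<zeta> G pmin pmax p \<longleftrightarrow> p = clipped" for p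
    using clipped_formula_unique_nash[OF clipping] .
  then have "\<exists>!p. nash_equilibrium B \<zeta> G pmin pmax p"
    by simp
  moreover have stackelberg:
    "stackelberg_equilibrium B \<zeta> G pmin pmax pd \<longleftrightarrow> pd = (clipped, demand B \<zeta> clipped)" for pd
    by (cases pd) (auto simp: stackelberg_equilibrium_def nash)
  then have "\<exists>!pd. stackelberg_equilibrium B \<zeta> G pmin pmax pd"
    by simp
  moreover have "is_arg_max (utility (\<gamma> n) (\<zeta> n)) (\<lambda>d. d \<in> consumer_feasible (B n) (E n) p) d
      \<longleftrightarrow> d = demand B \<zeta> p n"
    if "p \<in> price_box pmin pmax" "\<forall>k t. demand B \<zeta> p n k t \<ge> 0" for p n d
    using that assms(3,6) zeta_pos
    by (intro demand_is_unique_maximizer budget) (auto simp: price_box_def)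
  ultimately show ?thesis
    using nash stackelberg by blast
qed

end
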